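(* For all integers $a,b\geq 1$, the double star $S_{a,b}$ satisfies $$\tau(S_{a,b})\leq\min\left\{-(3+2\sqrt{2})+(1+\sqrt{2})\left(a+b+\tfrac{3}{2}\right),\ 2(a+b+4)\right\}.$$
   Context: Graphs are finite and simple, not necessarily connected. For a graph $G$ with $m$ edges and a bijection $f: E(G)\to\{1,2,\dots,m\}$, let $\phi_f(v)$ be the sum of $f(e)$ over all edges $e$ incident to the vertex $v$. The bijection $f$ is an antimagic labeling of $G$ if $\phi_f(u)\neq\phi_f(v)$ for all pairs of distinct vertices $u,v$; $G$ is antimagic if it admits an antimagic labeling. $P_j$ is the path on $j$ vertices. $G\cup H$ denotes disjoint union, and $tG$ the disjoint union of $t$ copies of $G$. The star $S_n$ is a tree with a (designated) center vertex $v$ and $n$ pendant edges incident to $v$. The double star $S_{a,b}$ is the tree obtained from disjoint stars $S_a$ and $S_b$ by adding an edge between their centers; it has $a+b+1$ edges. If $G$ is antimagic, $\tau(G)$ is the maximum non-negative integer $t$ such that $G\cup t'P_3$ is antimagic for all integers $0\leq t'\leq t$; if $G$ is not antimagic, $\tau(G)=-\infty$. *)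

theory Defs
  imports Complex_Main "HOL-Library.Extended_Real"
begin

text \<open>A graph is a vertex set together with a set of edges, each edge being the
  two-element set of its endpoints.\<close>

type_synonym 'a graph = "'a set \<times> 'a set set"

abbreviation verts :: "'a graph \<Rightarrow> 'a set" where "verts G \<equiv> fst G"
abbreviation edges :: "'a graph \<Rightarrow> 'a set set" where "edges G \<equiv> snd G"

definition finite_simple_graph :: "'a graph \<Rightarrow> bool" where
  "finite_simple_graph G \<longleftrightarrow>
     finite (verts G) \<and> (\<forall>e\<in>edges G. e \<subseteq> verts G \<and> card e = 2)"

definition vertex_sum :: "'a graph \<Rightarrow> ('a set \<Rightarrow> nat) \<Rightarrow> 'a \<Rightarrow> nat" where
  "vertex_sum G f v = (\<Sum>e | e \<in> edges G \<and> v \<in> e. f e)"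

definition antimagic_labeling :: "'a graph \<Rightarrow> ('a set \<Rightarrow> nat) \<Rightarrow> bool" where
  "antimagic_labeling G f \<longleftrightarrow>
     bij_betw f (edges G) {1..card (edges G)} \<and>
     (\<forall>u\<in>verts G. \<forall>v\<in>verts G. u \<noteq> v \<longrightarrow> vertex_sum G f u \<noteq> vertex_sum G f v)"

definition antimagic :: "'a graph \<Rightarrow> bool" where
  "antimagic G \<longleftrightarrow> (\<exists>f. antimagic_labeling G f)"

definition disjoint_union :: "'a graph \<Rightarrow> 'b graph \<Rightarrow> ('a + 'b) graph" where
  "disjoint_union G H =
     (Inl ` verts G \<union> Inr ` verts H, (`) Inl ` edges G \<union> (`) Inr ` edges H)"

definition copies :: "nat \<Rightarrow> 'a graph \<Rightarrow> (nat \<times> 'a) graph" where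
  "copies t G = ({..<t} \<times> verts G, {Pair i ` e | i e. i < t \<and> e \<in> edges G})"

definition path_graph :: "nat \<Rightarrow> nat graph" where
  "path_graph j = ({..<j}, {{i, Suc i} | i. Suc i < j})"

text \<open>The center of the star is the vertex 0.\<close>

definition star :: "nat \<Rightarrow> nat graph" where
  "star n = ({0..n}, {{0, i} | i. i \<in> {1..n}})"

definition double_star :: "nat \<Rightarrow> nat \<Rightarrow> (nat + nat) graph" where
  "double_star a b =
     (verts (disjoint_union (star a) (star b)),
      insert {Inl 0, Inr 0} (edges (disjoint_union (star a) (star b))))"

text \<open>The supremum is the maximum whenever the latter exists; it is \<open>\<infinity>\<close> if
  every number of added paths gives an antimagic graph.\<close>

definition tau :: "'a graph \<Rightarrow> ereal" where
  "tau G =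
     (if antimagic G
      then (SUP t \<in> {t::nat. \<forall>t'\<le>t. antimagic (disjoint_union G (copies t' (path_graph 3)))}.
              ereal (real t))
      else - \<infinity>)"

lemma finite_simple_graph_star: "finite_simple_graph (star n)"
  by (auto simp: finite_simple_graph_def star_def card_insert_if)

lemma finite_simple_graph_path_graph: "finite_simple_graph (path_graph j)"
  by (auto simp: finite_simple_graph_def path_graph_def card_insert_if)

lemma finite_simple_graph_disjoint_union:
  assumes "finite_simple_graph G" "finite_simple_graph H"
  shows "finite_simple_graph (disjoint_union G H)"
  using assms
  by (fastforce simp: finite_simple_graph_def disjoint_union_def card_image inj_on_def)

lemma finite_simple_graph_copies:
  assumes "finite_simple_graph G"
  shows "finite_simple_graph (copies t G)"
  using assms
  by (fastforce simp: finite_simple_graph_def copies_def card_image inj_on_def)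

lemma finite_simple_graph_double_star: "finite_simple_graph (double_star a b)"
  using finite_simple_graph_disjoint_union
    [OF finite_simple_graph_star[of a] finite_simple_graph_star[of b]]
  by (auto simp: finite_simple_graph_def double_star_def disjoint_union_def star_def)

lemma card_edges_star: "card (edges (star n)) = n"
proof -
  have "edges (star n) = (\<lambda>i. {0, i}) ` {1..n}"
    by (auto simp: star_def)
  moreover have "inj_on (\<lambda>i. {0, i}) {1..n}"
    by (auto simp: inj_on_def doubleton_eq_iff)
  ultimately show ?thesis
    by (simp add: card_image)
qed

lemma card_edges_double_star: "card (edges (double_star a b)) = a + b + 1"
proof -
  have fin: "finite (edges (star n))" for n
    by (simp add: star_def)
  have inj: "inj_on ((`) Inl) A" "inj_on ((`) Inr) B" for A :: "nat set set" and B :: "nat set set"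
    by (auto simp: inj_on_def inj_image_eq_iff)
  have "(`) Inl ` edges (star a) \<inter> (`) Inr ` edges (star b) = {}"
    by (auto simp: star_def)
  then have "card (edges (disjoint_union (star a) (star b))) = a + b"
    using fin by (simp add: disjoint_union_def card_Un_disjoint card_image inj card_edges_star)
  moreover have "{Inl 0, Inr 0} \<notin> edges (disjoint_union (star a) (star b))"
    by (auto simp: disjoint_union_def)
  ultimately show ?thesis
    using fin by (simp add: double_star_def disjoint_union_def)
qed

end

theory Submission
  imports Defs
begin

text \<open>
  Let \<open>k = a + b + 1\<close> be the number of edges of the double star and suppose that adding \<open>t\<close>
  paths \<open>P\<^sub>3\<close> leaves an antimagic graph, which then has \<open>m = k + 2 t\<close> edges and
  \<open>n = k + 1 + 3 t\<close> vertices. Each of the two bounds on \<open>t\<close> comes from comparing a sum of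
  distinct natural numbers with the least or greatest value that such a sum can take.

  For the bound with \<open>sqrt 2\<close> (\<open>antimagic_no_isolated_bound\<close>), the \<open>n\<close> vertex sums are
  distinct and, as no vertex is isolated, positive, so their total is at least
  \<open>n (n + 1) / 2\<close>. Every label counts twice in this total, which is therefore
  \<open>m (m + 1)\<close>. The resulting quadratic inequality
  \<open>t\<^sup>2 - (2 k - 5) t \<le> k\<^sup>2 - k - 2\<close> is solved for \<open>t\<close> in \<open>quadratic_bound\<close>.

  For the linear bound (\<open>antimagic_all_but_one_pendant_bound\<close>), every edge except the one
  joining the two centers of the double star ends in a leaf, and the sum at that leaf is the
  label of the edge. Every label but one is thus already taken as a vertex sum, and the middle
  vertices of the paths, whose sums are distinct, must all but one have a sum above \<open>m\<close>.
  These \<open>r \<ge> t - 1\<close> sums total at least \<open>(m + 1) + \<dots> + (m + r)\<close>. On the other hand they are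
  made of \<open>2 r\<close> distinct labels and total at most \<open>m + (m - 1) + \<dots> + (m - 2 r + 1)\<close>.
  If \<open>r > 0\<close>, dividing the comparison by \<open>r\<close> gives \<open>5 r \<le> 2 m + 1 = 2 k + 4 t + 1\<close>, hence \<open>t \<le> 2 k + 6\<close>;
  if \<open>r = 0\<close>, then \<open>t \<le> 1\<close>.
\<close>

section \<open>Sums of distinct natural numbers\<close>

text \<open>The largest element of a set is at least the number of its other elements, so the sum
  is at least \<open>0 + 1 + \<dots> + (card S - 1)\<close>. The factor \<open>2\<close> here and
  below avoids division.\<close>

lemma sum_distinct_nats_ge:
  fixes S :: "nat set"
  assumes "finite S"
  shows "card S * (card S - 1) \<le> 2 * \<Sum>S"
  using assms
proof (induction S rule: finite_linorder_max_induct)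
  case empty
  then show ?case by simp
next
  case (insert b A)
  have "A \<subseteq> {..<b}" using insert.hyps by auto
  then have "card A \<le> b" using card_mono[of "{..<b}" A] by simp
  moreover have "Suc (card A) * card A = card A * (card A - 1) + 2 * card A"
    by (cases "card A") auto
  moreover have "b \<notin> A" using insert.hyps by auto
  ultimately show ?case using insert by simp
qed

text \<open>The next two bounds follow by moving the set to start at \<open>0\<close>: by the
  shift \<open>x \<mapsto> x - (m + 1)\<close> and by the reflection \<open>x \<mapsto> m - x\<close>.\<close>

lemma sum_distinct_nats_above:
  fixes S :: "nat set"
  assumes "finite S" and above: "\<And>x. x \<in> S \<Longrightarrow> m < x"
  shows "card S * (2 * m + card S + 1) \<le> 2 * \<Sum>S"
proof -
  have inj: "inj_on (\<lambda>x. x - Suc m) S"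
    by (intro inj_on_diff_nat) (use above in \<open>auto simp: Suc_le_eq\<close>)
  have "card S * (card S - 1) \<le> 2 * (\<Sum>x\<in>S. x - Suc m)"
    using sum_distinct_nats_ge[of "(\<lambda>x. x - Suc m) ` S"] assms(1) inj
    by (simp add: card_image sum.reindex)
  moreover have "\<Sum>S = (\<Sum>x\<in>S. (x - Suc m) + Suc m)"
    by (rule sum.cong[OF refl]) (metis above Suc_leI le_add_diff_inverse2)
  then have "\<Sum>S = (\<Sum>x\<in>S. x - Suc m) + card S * Suc m"
    by (simp only: sum.distrib sum_constant of_nat_id)
  moreover have "card S * (2 * m + card S + 1) = card S * (card S - 1) + 2 * (card S * Suc m)"
    by (cases "card S") (auto simp: algebra_simps)
  ultimately show ?thesis by simp
qed

lemma sum_distinct_nats_below: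
  fixes S :: "nat set"
  assumes below: "\<And>x. x \<in> S \<Longrightarrow> x \<le> m"
  shows "2 * \<Sum>S + card S * (card S - 1) \<le> 2 * m * card S"
proof -
  have fin: "finite S" using below finite_nat_set_iff_bounded_le by blast
  have inj: "inj_on (\<lambda>x. m - x) S"
    by (rule inj_onI) (use below in \<open>metis diff_diff_cancel\<close>)
  have "card S * (card S - 1) \<le> 2 * (\<Sum>x\<in>S. m - x)"
    using sum_distinct_nats_ge[of "(\<lambda>x. m - x) ` S"] fin inj
    by (simp add: card_image sum.reindex)
  moreover have "\<Sum>S + (\<Sum>x\<in>S. m - x) = (\<Sum>x\<in>S. m)"
    unfolding sum.distrib[symmetric] by (intro sum.cong) (use below in auto)
  ultimately show ?thesis by (simp add: algebra_simps)
qed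

section \<open>Incident edges\<close>

definition incident :: "'a graph \<Rightarrow> 'a \<Rightarrow> 'a set set" where
  "incident G v = {e \<in> edges G. v \<in> e}"

lemma vertex_sum_incident: "vertex_sum G f v = sum f (incident G v)"
  by (simp add: vertex_sum_def incident_def)

text \<open>The definition asks for an endpoint on no other edge rather than for a vertex of degree
  one, because what matters is that the sum at this endpoint is the label of the edge.\<close>

definition pendant_edge :: "'a graph \<Rightarrow> 'a set \<Rightarrow> bool" where
  "pendant_edge G e \<longleftrightarrow> (\<exists>w\<in>verts G. incident G w = {e})"

lemma finite_edges:
  assumes "finite_simple_graph G"
  shows "finite (edges G)"
proof (rule finite_subset)
  show "edges G \<subseteq> Pow (verts G)" and "finite (Pow (verts G))"
    using assms by (auto simp: finite_simple_graph_def)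
qed

text \<open>The handshake lemma with weights: each label is counted at both ends of its edge.\<close>

lemma sum_vertex_sum:
  assumes "finite_simple_graph G"
  shows "(\<Sum>v\<in>verts G. vertex_sum G f v) = 2 * sum f (edges G)"
proof -
  have "(\<Sum>v\<in>verts G. vertex_sum G f v)
      = (\<Sum>e\<in>edges G. \<Sum>v | v \<in> verts G \<and> v \<in> e. f e)"
    unfolding vertex_sum_def
    by (rule sum.swap_restrict)
      (use assms finite_edges[OF assms] in \<open>auto simp: finite_simple_graph_def\<close>)
  also have "\<dots> = (\<Sum>e\<in>edges G. 2 * f e)"
  proof (rule sum.cong)
    fix e assume "e \<in> edges G"
    then have "{v. v \<in> verts G \<and> v \<in> e} = e" and "card e = 2"
      using assms by (auto simp: finite_simple_graph_def)
    then show "(\<Sum>v | v \<in> verts G \<and> v \<in> e. f e) = 2 * f e" by simp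
  qed simp
  finally show ?thesis by (simp add: sum_distrib_left)
qed

lemma incident_disjoint_union_Inl:
  "incident (disjoint_union G H) (Inl v) = (`) Inl ` incident G v"
  by (auto simp: incident_def disjoint_union_def)

lemma incident_disjoint_union_Inr:
  "incident (disjoint_union G H) (Inr v) = (`) Inr ` incident H v"
  by (auto simp: incident_def disjoint_union_def)

lemma incident_copies:
  "i < t \<Longrightarrow> incident (copies t G) (i, v) = (`) (Pair i) ` incident G v"
  by (auto simp: incident_def copies_def)

lemma pendant_edge_Inl:
  assumes "pendant_edge G e"
  shows "pendant_edge (disjoint_union G H) (Inl ` e)"
proof -
  obtain w where "w \<in> verts G" and "incident G w = {e}"
    using assms by (auto simp: pendant_edge_def)
  then show ?thesis
    unfolding pendant_edge_def
    by (intro bexI[of _ "Inl w"])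
      (simp add: incident_disjoint_union_Inl, simp add: disjoint_union_def)
qed

lemma pendant_edge_Inr:
  assumes "pendant_edge H e"
  shows "pendant_edge (disjoint_union G H) (Inr ` e)"
proof -
  obtain w where "w \<in> verts H" and "incident H w = {e}"
    using assms by (auto simp: pendant_edge_def)
  then show ?thesis
    unfolding pendant_edge_def
    by (intro bexI[of _ "Inr w"])
      (simp add: incident_disjoint_union_Inr, simp add: disjoint_union_def)
qed

lemma pendant_edge_copies:
  assumes "i < t" and "pendant_edge G e"
  shows "pendant_edge (copies t G) (Pair i ` e)"
proof -
  obtain w where "w \<in> verts G" and "incident G w = {e}"
    using assms(2) by (auto simp: pendant_edge_def)
  then show ?thesis
    unfolding pendant_edge_def
    by (intro bexI[of _ "(i, w)"])
      (use assms(1) in \<open>simp_all add: incident_copies, simp add: copies_def\<close>)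
qed

lemma card_verts_disjoint_union:
  assumes "finite_simple_graph G" and "finite_simple_graph H"
  shows "card (verts (disjoint_union G H)) = card (verts G) + card (verts H)"
  using assms card_Plus[of "verts G" "verts H"]
  by (simp add: disjoint_union_def finite_simple_graph_def Plus_def)

lemma card_edges_disjoint_union:
  fixes G :: "'a graph" and H :: "'b graph"
  assumes "finite_simple_graph G" and "finite_simple_graph H"
  shows "card (edges (disjoint_union G H)) = card (edges G) + card (edges H)"
proof -
  have "e \<noteq> {}" if "e \<in> edges G" for e
    using that assms(1) by (auto simp: finite_simple_graph_def)
  then have "(Inl ` d :: ('a + 'b) set) \<noteq> Inr ` e" if "d \<in> edges G" for d e
    using that by (metis Inl_Inr_False ex_in_conv image_iff)
  then have "(`) Inl ` edges G \<inter> (`) Inr ` edges H = {}" by auto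
  moreover have "card ((`) (Inl :: 'a \<Rightarrow> 'a + 'b) ` edges G) = card (edges G)"
    and "card ((`) (Inr :: 'b \<Rightarrow> 'a + 'b) ` edges H) = card (edges H)"
    by (intro card_image; simp add: inj_on_def inj_image_eq_iff)+
  ultimately show ?thesis
    using assms[THEN finite_edges] by (simp add: disjoint_union_def card_Un_disjoint)
qed

lemma card_verts_copies: "card (verts (copies t G)) = t * card (verts G)"
  by (simp add: copies_def card_cartesian_product)

lemma card_edges_copies:
  assumes "finite_simple_graph G"
  shows "card (edges (copies t G)) = t * card (edges G)"
proof -
  have ne: "e \<noteq> {}" if "e \<in> edges G" for e
    using that assms by (auto simp: finite_simple_graph_def)
  have "edges (copies t G) = (\<lambda>(i, e). Pair i ` e) ` ({..<t} \<times> edges G)"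
    by (auto simp: copies_def)
  moreover have "inj_on (\<lambda>(i, e). Pair i ` e) ({..<t} \<times> edges G)"
  proof (rule inj_onI; clarify)
    fix i j d e
    assume "d \<in> edges G" and eq: "Pair i ` d = Pair j ` e"
    then have "i = j" using ne by fastforce
    moreover have "d = snd ` Pair i ` d" and "e = snd ` Pair j ` e"
      by (simp_all add: image_image)
    ultimately show "i = j \<and> d = e" using eq by metis
  qed
  ultimately show ?thesis by (simp add: card_image card_cartesian_product)
qed

section \<open>Double stars and paths on three vertices\<close>

lemma edges_path3: "edges (path_graph 3) = {{0, 1}, {1, 2}}"
proof -
  have "Suc i < 3 \<longleftrightarrow> i = 0 \<or> i = 1" for i by auto
  then show ?thesis by (auto simp: path_graph_def numeral_2_eq_2)
qed

lemma incident_path3: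
  "incident (path_graph 3) 0 = {{0, 1}}"
  "incident (path_graph 3) 1 = {{0, 1}, {1, 2}}"
  "incident (path_graph 3) 2 = {{1, 2}}"
  unfolding incident_def edges_path3 by auto

lemma verts_path3: "verts (path_graph 3) = {0, 1, 2}"
  by (auto simp: path_graph_def)

lemma card_verts_path3: "card (verts (path_graph 3)) = 3"
  by (simp add: path_graph_def)

lemma card_edges_path3: "card (edges (path_graph 3)) = 2"
  unfolding edges_path3 by (simp add: doubleton_eq_iff)

lemma pendant_edge_path3: "e \<in> edges (path_graph 3) \<Longrightarrow> pendant_edge (path_graph 3) e"
  unfolding pendant_edge_def edges_path3 verts_path3 using incident_path3 by auto

lemma edges_double_star:
  "edges (double_star a b) = insert {Inl 0, Inr 0}
     ({{Inl 0, Inl i} | i. i \<in> {1..a}} \<union> {{Inr 0, Inr i} | i. i \<in> {1..b}})"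
proof -
  have "(`) g ` {{0, i} | i. i \<in> {1..n}} = {{g 0, g i} | i. i \<in> {1..n}}"
    for g :: "nat \<Rightarrow> nat + nat" and n
    by (simp add: setcompr_eq_image image_image)
  then show ?thesis by (simp add: double_star_def disjoint_union_def star_def)
qed

lemma verts_double_star: "verts (double_star a b) = Inl ` {0..a} \<union> Inr ` {0..b}"
  by (simp add: double_star_def disjoint_union_def star_def)

lemma card_verts_double_star: "card (verts (double_star a b)) = a + b + 2"
  unfolding verts_double_star using card_Plus[of "{0..a}" "{0..b}"] by (simp add: Plus_def)

lemma pendant_edge_double_star:
  assumes "e \<in> edges (double_star a b)" and "e \<noteq> {Inl 0, Inr 0}"
  shows "pendant_edge (double_star a b) e"
proof -
  consider i where "i \<in> {1..a}" "e = {Inl 0, Inl i}" | i where "i \<in> {1..b}" "e = {Inr 0, Inr i}"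
    using assms by (auto simp: edges_double_star)
  then show ?thesis
  proof cases
    case 1
    then have "incident (double_star a b) (Inl i) = {e}"
      by (auto simp: incident_def edges_double_star)
    with 1 show ?thesis unfolding pendant_edge_def verts_double_star by auto
  next
    case 2
    then have "incident (double_star a b) (Inr i) = {e}"
      by (auto simp: incident_def edges_double_star)
    with 2 show ?thesis unfolding pendant_edge_def verts_double_star by auto
  qed
qed

lemma incident_double_star_nonempty:
  assumes "v \<in> verts (double_star a b)"
  shows "incident (double_star a b) v \<noteq> {}"
proof -
  have "\<exists>e\<in>edges (double_star a b). v \<in> e"
  proof (cases v)
    case (Inl i)
    show ?thesis
    proof (cases "i = 0")
      case True
      then show ?thesis using Inl by (auto simp: edges_double_star)
    next
      case False
      then have "{Inl 0, Inl i} \<in> edges (double_star a b)"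
        using Inl assms by (auto simp: edges_double_star verts_double_star)
      then show ?thesis using Inl by blast
    qed
  next
    case (Inr i)
    show ?thesis
    proof (cases "i = 0")
      case True
      then show ?thesis using Inr by (auto simp: edges_double_star)
    next
      case False
      then have "{Inr 0, Inr i} \<in> edges (double_star a b)"
        using Inr assms by (auto simp: edges_double_star verts_double_star)
      then show ?thesis using Inr by blast
    qed
  qed
  then show ?thesis by (auto simp: incident_def)
qed

section \<open>Counting bounds for antimagic labelings\<close>

text \<open>With \<open>n\<close> vertices the vertex sums are \<open>n\<close> distinct positive integers, so twice their total
  is at least \<open>n (n + 1)\<close>; by the handshake lemma their total is \<open>2 (1 + \<dots> + m) = m (m + 1)\<close>.
  The inequality bites when there are more vertices than edges, and each added \<open>P\<^sub>3\<close>
  increases this excess by one.\<close>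

lemma antimagic_no_isolated_bound:
  assumes G: "finite_simple_graph G" and "antimagic G"
    and no_isolated: "\<And>v. v \<in> verts G \<Longrightarrow> incident G v \<noteq> {}"
  shows "card (verts G) * (card (verts G) + 1) \<le> 2 * (card (edges G) * (card (edges G) + 1))"
proof -
  obtain f where f: "antimagic_labeling G f" using assms(2) by (auto simp: antimagic_def)
  define m where "m = card (edges G)"
  have bij: "bij_betw f (edges G) {1..m}"
    using f by (simp add: antimagic_labeling_def m_def)
  have inj: "inj_on (vertex_sum G f) (verts G)"
    using f by (auto simp: antimagic_labeling_def inj_on_def)
  define S where "S = vertex_sum G f ` verts G"
  have "card S = card (verts G)" unfolding S_def using inj by (rule card_image)
  moreover have "\<Sum>S = (\<Sum>v\<in>verts G. vertex_sum G f v)"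
    unfolding S_def using inj by (simp add: sum.reindex)
  moreover have "card S * (2 * 0 + card S + 1) \<le> 2 * \<Sum>S"
  proof (rule sum_distinct_nats_above)
    show "finite S" using G by (simp add: S_def finite_simple_graph_def)
    fix x assume "x \<in> S"
    then obtain v where v: "v \<in> verts G" and x: "x = sum f (incident G v)"
      by (auto simp: S_def vertex_sum_incident)
    then obtain e where e: "e \<in> incident G v" using no_isolated by blast
    then have "e \<in> edges G" by (simp add: incident_def)
    then have "f e \<in> {1..m}" using bij bij_betwE by blast
    moreover have "f e \<le> x"
      unfolding x by (rule member_le_sum) (use e finite_edges[OF G] in \<open>auto simp: incident_def\<close>)
    ultimately show "0 < x" by simp
  qed
  moreover have "sum f (edges G) = \<Sum>{1..m}"
    using sum.reindex_bij_betw[OF bij, of "\<lambda>x. x"] by simp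
  moreover have "2 * \<Sum>{1..m} = m * (m + 1)"
    using gauss_sum_from_Suc_0[of m, where 'a = nat] by simp
  ultimately show ?thesis using sum_vertex_sum[OF G, of f] by (simp add: m_def)
qed

text \<open>Labels of pendant edges are already used as vertex sums at leaves, so the middle vertex of
  an added path can have a sum at most \<open>m\<close> only if this sum is the label of the exceptional edge
  \<open>e\<^sub>0\<close>; this happens for at most one path. The other middle vertices need large sums, but the
  labels available to them are at most \<open>m\<close> and distinct.\<close>

lemma antimagic_all_but_one_pendant_bound:
  fixes G :: "'a graph"
  assumes G: "finite_simple_graph G"
    and anti: "antimagic (disjoint_union G (copies t (path_graph 3)))"
    and pend: "\<And>e. e \<in> edges G \<Longrightarrow> e \<noteq> e\<^sub>0 \<Longrightarrow> pendant_edge G e"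
  shows "t \<le> 2 * card (edges G) + 6"
proof -
  define U where "U = disjoint_union G (copies t (path_graph 3))"
  define m where "m = card (edges U)"
  obtain f where f: "antimagic_labeling U f"
    using anti by (auto simp: antimagic_def U_def)
  have bij: "bij_betw f (edges U) {1..m}"
    using f by (simp add: antimagic_labeling_def m_def)
  have m: "m = card (edges G) + 2 * t"
    unfolding m_def U_def using G
    by (simp add: card_edges_disjoint_union card_edges_copies card_edges_path3
        finite_simple_graph_copies finite_simple_graph_path_graph)

  have pendU: "pendant_edge U e" if e: "e \<in> edges U" and ne: "e \<noteq> Inl ` e\<^sub>0" for e
  proof -
    have "edges U = (`) Inl ` edges G \<union> (`) Inr ` edges (copies t (path_graph 3))"
      by (simp add: U_def disjoint_union_def)
    with e consider d where "d \<in> edges G" "e = Inl ` d"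
      | d where "d \<in> edges (copies t (path_graph 3))" "e = Inr ` d"
      by auto
    then show ?thesis
    proof cases
      case 1
      then show ?thesis unfolding U_def using ne pend pendant_edge_Inl by blast
    next
      case 2
      then obtain i d' where "i < t" "d' \<in> edges (path_graph 3)" "d = Pair i ` d'"
        by (auto simp: copies_def)
      then have "pendant_edge (copies t (path_graph 3)) d"
        using pendant_edge_copies pendant_edge_path3 by blast
      then show ?thesis unfolding U_def \<open>e = Inr ` d\<close> by (rule pendant_edge_Inr)
    qed
  qed

  define c :: "nat \<Rightarrow> 'a + nat \<times> nat" where "c i = Inr (i, 1)" for i
  define s where "s i = vertex_sum U f (c i)" for i
  have c_verts: "c i \<in> verts U" if "i < t" for i
    using that by (auto simp: U_def c_def disjoint_union_def copies_def verts_path3)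
  have inc_c: "incident U (c i) = {Inr ` {(i, 0), (i, 1)}, Inr ` {(i, 1), (i, 2)}}"
    if "i < t" for i
    unfolding U_def c_def incident_disjoint_union_Inr incident_copies[OF that] incident_path3
    by simp
  have card_inc_c: "card (incident U (c i)) = 2" if "i < t" for i
    unfolding inc_c[OF that] by (auto simp: doubleton_eq_iff)
  have inj_s: "inj_on s {..<t}"
  proof (rule inj_onI)
    fix i j assume "i \<in> {..<t}" "j \<in> {..<t}" "s i = s j"
    then have "c i = c j"
      using f c_verts by (auto simp: s_def antimagic_labeling_def)
    then show "i = j" by (simp add: c_def)
  qed

  have s_pos: "1 \<le> s i" if i: "i < t" for i
  proof -
    obtain e where e: "e \<in> incident U (c i)" using inc_c[OF i] by blast
    then have "f e \<in> {1..m}" using bij bij_betwE by (fastforce simp: incident_def)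
    moreover have "f e \<le> s i"
      unfolding s_def vertex_sum_incident
      by (rule member_le_sum) (use e in \<open>auto simp: inc_c[OF i]\<close>)
    ultimately show ?thesis by simp
  qed
  have s_small: "s i = f (Inl ` e\<^sub>0)" if i: "i < t" and le: "s i \<le> m" for i
  proof -
    have "s i \<in> f ` edges U" using bij s_pos[OF i] le by (simp add: bij_betw_def)
    then obtain e where e: "e \<in> edges U" "s i = f e" by blast
    \<comment> \<open>The leaf of a pendant edge would share the sum \<open>f e\<close> with the middle vertex \<open>c i\<close>, which
      has two incident edges and so is not that leaf.\<close>
    have "\<not> pendant_edge U e"
    proof
      assume "pendant_edge U e"
      then obtain w where w: "w \<in> verts U" "incident U w = {e}" by (auto simp: pendant_edge_def)
      then have "vertex_sum U f w = vertex_sum U f (c i)"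
        using e by (simp add: vertex_sum_incident[of U f w] s_def)
      then have "w = c i" using f w c_verts[OF i] by (auto simp: antimagic_labeling_def)
      then show False using w card_inc_c[OF i] by simp
    qed
    then have "e = Inl ` e\<^sub>0" using pendU e(1) by blast
    then show ?thesis using e by simp
  qed

  define I where "I = {i. i < t \<and> m < s i}"
  define r where "r = card I"
  have finI: "finite I" by (simp add: I_def)
  have "t \<le> r + 1"
  proof -
    have "inj_on s ({..<t} - I)" using inj_s by (rule inj_on_subset) auto
    moreover have "s ` ({..<t} - I) \<subseteq> {f (Inl ` e\<^sub>0)}"
      using s_small by (fastforce simp: I_def)
    ultimately have "card ({..<t} - I) \<le> card {f (Inl ` e\<^sub>0)}"
      by (intro card_inj_on_le) auto
    moreover have "card ({..<t} - I) = t - r"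
      unfolding r_def by (subst card_Diff_subset) (auto simp: I_def)
    ultimately show ?thesis by simp
  qed

  have inj_sI: "inj_on s I" using inj_s by (rule inj_on_subset) (auto simp: I_def)
  have lower: "r * (2 * m + r + 1) \<le> 2 * (\<Sum>i\<in>I. s i)"
  proof -
    have "finite (s ` I)" and "\<And>x. x \<in> s ` I \<Longrightarrow> m < x"
      using finI by (auto simp: I_def)
    from sum_distinct_nats_above[OF this] show ?thesis
      by (simp add: card_image[OF inj_sI] sum.reindex[OF inj_sI] r_def)
  qed

  \<comment> \<open>The \<open>2 r\<close> edges of the paths whose middle vertex has a sum above \<open>m\<close>.\<close>
  define J where "J = (\<Union>i\<in>I. incident U (c i))"
  have disj: "incident U (c i) \<inter> incident U (c j) = {}" if "i \<in> I" "j \<in> I" "i \<noteq> j" for i j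
    using that by (auto simp: I_def inc_c doubleton_eq_iff)
  have fin_inc: "finite (incident U (c i))" if "i \<in> I" for i
    using that by (auto simp: I_def inc_c)
  have "card J = (\<Sum>i\<in>I. card (incident U (c i)))"
    unfolding J_def by (rule card_UN_disjoint) (use finI fin_inc disj in auto)
  then have cardJ: "card J = 2 * r"
    by (simp add: card_inc_c I_def r_def)
  have sumJ: "sum f J = (\<Sum>i\<in>I. s i)"
    unfolding J_def s_def vertex_sum_incident
    by (rule sum.UNION_disjoint) (use finI fin_inc disj in auto)
  have "J \<subseteq> edges U" by (auto simp: J_def incident_def)
  then have injJ: "inj_on f J" and fJ: "f ` J \<subseteq> {1..m}"
    using bij by (auto simp: bij_betw_def intro: inj_on_subset)
  have upper: "2 * (\<Sum>i\<in>I. s i) + 2 * r * (2 * r - 1) \<le> 2 * m * (2 * r)"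
  proof -
    have "\<And>x. x \<in> f ` J \<Longrightarrow> x \<le> m" using fJ by auto
    from sum_distinct_nats_below[of "f ` J" m, OF this] show ?thesis
      by (simp add: card_image[OF injJ] cardJ sum.reindex[OF injJ] sumJ)
  qed

  show ?thesis
  proof (cases "r = 0")
    case True
    then show ?thesis using \<open>t \<le> r + 1\<close> by simp
  next
    case False
    have "r * (2 * m + r + 1 + 2 * (2 * r - 1)) \<le> r * (4 * m)"
      using lower upper by (simp add: algebra_simps)
    then have "2 * m + r + 1 + 2 * (2 * r - 1) \<le> 4 * m"
      using False by (simp only: mult_le_cancel1)
    then show ?thesis using m \<open>t \<le> r + 1\<close> False by linarith
  qed
qed

section \<open>The two bounds for double stars\<close>

text \<open>Completing the square turns the hypothesis into
  \<open>(t - k + 5/2)\<^sup>2 + 1/4 \<le> 2 (k - 3/2)\<^sup>2\<close>. Dropping the \<open>1/4\<close> leaves a comparison of two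
  real squares, so that a root can be taken; the bound obtained is linear in \<open>k\<close>, with slope
  \<open>1 + sqrt 2\<close>.\<close>

lemma quadratic_bound:
  fixes k t :: real
  assumes "3 / 2 \<le> k"
    and "(k + 3 * t + 1) * (k + 3 * t + 2) \<le> 2 * ((k + 2 * t) * (k + 2 * t + 1))"
  shows "t \<le> - (3 + 2 * sqrt 2) + (1 + sqrt 2) * (k + 1 / 2)"
proof -
  have "(t - (k - 5 / 2))\<^sup>2 \<le> 2 * (k - 3 / 2)\<^sup>2"
    using assms(2) by (simp add: power2_eq_square algebra_simps)
  also have "\<dots> = (sqrt 2 * (k - 3 / 2))\<^sup>2"
    by (simp add: power_mult_distrib)
  finally have "t - (k - 5 / 2) \<le> sqrt 2 * (k - 3 / 2)"
    by (rule power2_le_imp_le) (use assms(1) in simp)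
  then show ?thesis by (simp add: algebra_simps)
qed

theorem corollary5:
  fixes a b :: nat
  assumes "a \<ge> 1" and "b \<ge> 1"
  shows "tau (double_star a b) \<le>
    ereal (min (- (3 + 2 * sqrt 2) + (1 + sqrt 2) * (real a + real b + 3 / 2))
               (2 * (real a + real b + 4)))"
proof -
  have bounds: "real t \<le> min (- (3 + 2 * sqrt 2) + (1 + sqrt 2) * (real a + real b + 3 / 2))
      (2 * (real a + real b + 4))"
    if anti: "antimagic (disjoint_union (double_star a b) (copies t (path_graph 3)))" for t
  proof -
    let ?P = "copies t (path_graph 3)"
    let ?U = "disjoint_union (double_star a b) ?P"
    note fin = finite_simple_graph_double_star[of a b]
      finite_simple_graph_copies[OF finite_simple_graph_path_graph, of t 3]
    have "incident ?U v \<noteq> {}" if v: "v \<in> verts ?U" for v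
    proof -
      consider w where "w \<in> verts (double_star a b)" "v = Inl w"
        | i w where "i < t" "w \<in> verts (path_graph 3)" "v = Inr (i, w)"
        using v by (auto simp: disjoint_union_def copies_def)
      then show ?thesis
      proof cases
        case 1
        then show ?thesis
          by (simp add: incident_disjoint_union_Inl incident_double_star_nonempty)
      next
        case 2
        then consider "w = 0" | "w = 1" | "w = 2" by (auto simp: verts_path3)
        then have "incident (path_graph 3) w \<noteq> {}"
          by cases (simp_all only: incident_path3, simp_all)
        with 2 show ?thesis by (simp add: incident_disjoint_union_Inr incident_copies)
      qed
    qed
    from antimagic_no_isolated_bound[OF finite_simple_graph_disjoint_union[OF fin] anti this]
    have "(a + b + 2 + 3 * t) * (a + b + 2 + 3 * t + 1)
        \<le> 2 * ((a + b + 1 + 2 * t) * (a + b + 1 + 2 * t + 1))"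
      using fin
      by (simp add: card_verts_disjoint_union card_edges_disjoint_union card_verts_copies
          card_edges_copies[OF finite_simple_graph_path_graph] card_edges_path3 card_verts_path3
          card_verts_double_star card_edges_double_star mult.commute[of t])
    then have "real ((a + b + 2 + 3 * t) * (a + b + 2 + 3 * t + 1))
        \<le> real (2 * ((a + b + 1 + 2 * t) * (a + b + 1 + 2 * t + 1)))"
      by (rule of_nat_mono)
    then have "real t \<le> - (3 + 2 * sqrt 2) + (1 + sqrt 2) * ((real a + real b + 1) + 1 / 2)"
      by (intro quadratic_bound) (use assms in \<open>simp_all add: algebra_simps\<close>)
    moreover have "t \<le> 2 * (a + b + 1) + 6"
      using antimagic_all_but_one_pendant_bound
        [OF finite_simple_graph_double_star anti pendant_edge_double_star]
      by (simp add: card_edges_double_star)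
    then have "real t \<le> 2 * (real a + real b + 4)" by simp
    ultimately show ?thesis by (simp add: add.assoc)
  qed
  show ?thesis
  proof (cases "antimagic (double_star a b)")
    case True
    then show ?thesis
      unfolding tau_def if_P[OF True]
      by (intro SUP_least) (use bounds in \<open>blast intro: ereal_less_eq(3)[THEN iffD2]\<close>)
  next
    case False
    then show ?thesis by (simp add: tau_def)
  qed
qed

end
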